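(* The inclusion maps $$\mathcal{E}(X)=\mathbf{EMod}\big([0,1]^X,[0,1]\big)\hookrightarrow[0,1]^{([0,1]^X)}$$ form a map of monads from the expectation monad $\mathcal{E}$ to the continuation monad $X\mapsto C^{(C^X)}$ on the set $C=[0,1]$.
   Context: Effect algebra: a set $E$ with a partial commutative associative operation $\oplus$ with neutral element $0$ and a map $(-)^\perp$ such that, with $1:=0^\perp$, $x^\perp$ is the unique element with $x\oplus x^\perp=1$, and $x\oplus 1$ is defined only if $x=0$. Effect module: an effect algebra with scalar multiplication $[0,1]\times E\to E$ with $1x=x$, $(rs)x=r(sx)$, $(r+s)x=rx\oplus sx$ if $r+s\le1$, and $r(x\oplus y)=rx\oplus ry$ if $x\oplus y$ is defined. Category $\mathbf{EMod}$: maps preserve $1$, defined sums $\oplus$, and scalar multiplication. $[0,1]^X$ is an effect module pointwise. Expectation monad on $\mathbf{Sets}$: $\mathcal{E}(X)=\mathbf{EMod}([0,1]^X,[0,1])$, $\mathcal{E}(f)(h)(p)=h(p\circ f)$, unit $\eta(x)(p)=p(x)$, multiplication $\mu(h)(p)=h(\lambda k\in\mathcal{E}(X).\,k(p))$. Continuation monad on $\mathbf{Sets}$ for a set $C$: $\mathcal{C}(X)=C^{(C^X)}$, $\mathcal{C}(f)(h)(g)=h(g\circ f)$, unit $\eta(x)(g)=g(x)$, multiplication $\mu(H)(g)=H(\lambda k\in C^{(C^X)}.\,k(g))$. A map of monads is a natural transformation commuting with units and multiplications. *)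

theory Defs
  imports Complex_Main "HOL-Library.FuncSet"
begin

section \<open>Effect algebras and effect modules\<close>

record 'a effect_alg =
  carrier :: "'a set"
  psum :: "'a \<Rightarrow> 'a \<Rightarrow> 'a option"
  zero :: 'a
  orth :: "'a \<Rightarrow> 'a"

record 'a effect_mod = "'a effect_alg" +
  smult :: "real \<Rightarrow> 'a \<Rightarrow> 'a"

definition one :: "('a, 'm) effect_alg_scheme \<Rightarrow> 'a" where
  "one E = orth E (zero E)"

text \<open>The value \<open>None\<close> of \<^const>\<open>psum\<close> means that the sum is undefined; in the associativity law,
  \<^const>\<open>Option.bind\<close> makes one side defined iff the other one is.\<close>

locale effect_algebra =
  fixes E :: "('a, 'm) effect_alg_scheme"
  assumes psum_closed:
      "\<lbrakk>x \<in> carrier E; y \<in> carrier E; psum E x y = Some z\<rbrakk> \<Longrightarrow> z \<in> carrier E"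
    and zero_closed: "zero E \<in> carrier E"
    and orth_closed: "x \<in> carrier E \<Longrightarrow> orth E x \<in> carrier E"
    and psum_comm: "\<lbrakk>x \<in> carrier E; y \<in> carrier E\<rbrakk> \<Longrightarrow> psum E x y = psum E y x"
    and psum_assoc: "\<lbrakk>x \<in> carrier E; y \<in> carrier E; z \<in> carrier E\<rbrakk> \<Longrightarrow>
      Option.bind (psum E x y) (\<lambda>s. psum E s z) = Option.bind (psum E y z) (\<lambda>t. psum E x t)"
    and psum_zero: "x \<in> carrier E \<Longrightarrow> psum E x (zero E) = Some x"
    and psum_orth: "x \<in> carrier E \<Longrightarrow> psum E x (orth E x) = Some (one E)"
    and orth_unique:
      "\<lbrakk>x \<in> carrier E; y \<in> carrier E; psum E x y = Some (one E)\<rbrakk> \<Longrightarrow> y = orth E x"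
    and psum_one: "\<lbrakk>x \<in> carrier E; psum E x (one E) \<noteq> None\<rbrakk> \<Longrightarrow> x = zero E"

locale effect_module = effect_algebra E for E :: "('a, 'm) effect_mod_scheme" +
  assumes smult_closed: "\<lbrakk>r \<in> {0..1}; x \<in> carrier E\<rbrakk> \<Longrightarrow> smult E r x \<in> carrier E"
    and smult_one: "x \<in> carrier E \<Longrightarrow> smult E 1 x = x"
    and smult_smult: "\<lbrakk>r \<in> {0..1}; s \<in> {0..1}; x \<in> carrier E\<rbrakk> \<Longrightarrow>
      smult E (r * s) x = smult E r (smult E s x)"
    and smult_add: "\<lbrakk>r \<in> {0..1}; s \<in> {0..1}; r + s \<le> 1; x \<in> carrier E\<rbrakk> \<Longrightarrow>
      psum E (smult E r x) (smult E s x) = Some (smult E (r + s) x)"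
    and smult_psum:
      "\<lbrakk>r \<in> {0..1}; x \<in> carrier E; y \<in> carrier E; psum E x y = Some z\<rbrakk> \<Longrightarrow>
      psum E (smult E r x) (smult E r y) = Some (smult E r z)"

text \<open>Here and below, a map between carrier sets is a function that is extensional, i.e. fixed to
  be \<^const>\<open>undefined\<close> outside its domain, so that equality of functions is equality of maps.\<close>

definition emod_hom ::
  "('a, 'm) effect_mod_scheme \<Rightarrow> ('b, 'n) effect_mod_scheme \<Rightarrow> ('a \<Rightarrow> 'b) set" where
  "emod_hom E F = {h \<in> carrier E \<rightarrow>\<^sub>E carrier F.
     h (one E) = one F \<and>
     (\<forall>x \<in> carrier E. \<forall>y \<in> carrier E. \<forall>z.
        psum E x y = Some z \<longrightarrow> psum F (h x) (h y) = Some (h z)) \<and>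
     (\<forall>r \<in> {0..1}. \<forall>x \<in> carrier E. h (smult E r x) = smult F r (h x))}"

definition unit_emod :: "real effect_mod" where
  "unit_emod = \<lparr>carrier = {0..1}, psum = (\<lambda>x y. if x + y \<le> 1 then Some (x + y) else None),
     zero = 0, orth = (\<lambda>x. 1 - x), smult = (\<lambda>r x. r * x)\<rparr>"

definition power_emod :: "('a, 'm) effect_mod_scheme \<Rightarrow> 'x set \<Rightarrow> ('x \<Rightarrow> 'a) effect_mod" where
  "power_emod E X = \<lparr>carrier = X \<rightarrow>\<^sub>E carrier E,
     psum = (\<lambda>p q. if \<forall>x\<in>X. psum E (p x) (q x) \<noteq> None
                   then Some (\<lambda>x\<in>X. the (psum E (p x) (q x))) else None),
     zero = (\<lambda>x\<in>X. zero E), orth = (\<lambda>p. \<lambda>x\<in>X. orth E (p x)),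
     smult = (\<lambda>r p. \<lambda>x\<in>X. smult E r (p x))\<rparr>"

lemma one_unit_emod [simp]: "one unit_emod = 1"
  by (simp add: one_def unit_emod_def)

lemma one_power_emod: "one (power_emod E X) = (\<lambda>x\<in>X. one E)"
  by (auto simp: one_def power_emod_def)

lemma effect_module_unit_emod: "effect_module unit_emod"
proof unfold_locales
  fix r x y z :: real assume "r \<in> {0..1}" "x \<in> carrier unit_emod" "y \<in> carrier unit_emod"
    and "psum unit_emod x y = Some z"
  then have xy: "0 \<le> x + y" "x + y \<le> 1" "z = x + y"
    by (simp_all add: unit_emod_def split: if_splits)
  have "r * (x + y) \<le> 1" by (rule mult_le_one) (use xy \<open>r \<in> {0..1}\<close> in auto)
  with xy show "psum unit_emod (smult unit_emod r x) (smult unit_emod r y) = Some (smult unit_emod r z)"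
    by (simp add: unit_emod_def distrib_left)
next
  fix r s x :: real assume "r \<in> {0..1}" "s \<in> {0..1}" "r + s \<le> 1" "x \<in> carrier unit_emod"
  then have "(r + s) * x \<le> 1" by (intro mult_le_one) (auto simp: unit_emod_def)
  then show "psum unit_emod (smult unit_emod r x) (smult unit_emod s x) = Some (smult unit_emod (r + s) x)"
    by (simp add: unit_emod_def distrib_right)
qed (auto simp: unit_emod_def one_def mult_le_one add.commute add.assoc split: if_splits bind_splits)

lemma effect_module_power_emod:
  assumes "effect_module E"
  shows "effect_module (power_emod E X)"
proof -
  interpret effect_module E by (fact assms)
  note [simp] = psum_closed zero_closed orth_closed smult_closed
  have ext: "p = q" if "p \<in> carrier (power_emod E X)" "q \<in> carrier (power_emod E X)"
      "\<And>x. x \<in> X \<Longrightarrow> p x = q x" for p q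
    using that by (auto simp: power_emod_def intro: PiE_ext)
  have sum: "psum (power_emod E X) p q = Some r \<longleftrightarrow>
      r \<in> extensional X \<and> (\<forall>x\<in>X. psum E (p x) (q x) = Some (r x))" for p q r
  proof
    assume "psum (power_emod E X) p q = Some r"
    then have "\<forall>x\<in>X. psum E (p x) (q x) \<noteq> None" "r = (\<lambda>x\<in>X. the (psum E (p x) (q x)))"
      by (simp_all add: power_emod_def split: if_splits)
    then show "r \<in> extensional X \<and> (\<forall>x\<in>X. psum E (p x) (q x) = Some (r x))" by simp
  next
    assume "r \<in> extensional X \<and> (\<forall>x\<in>X. psum E (p x) (q x) = Some (r x))"
    moreover from this have "(\<lambda>x\<in>X. the (psum E (p x) (q x))) = r"
      by (intro extensionalityI[of _ X]) simp_all
    ultimately show "psum (power_emod E X) p q = Some r" by (simp add: power_emod_def)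
  qed
  have crr: "p \<in> carrier (power_emod E X) \<longleftrightarrow> p \<in> extensional X \<and> (\<forall>x\<in>X. p x \<in> carrier E)" for p
    by (auto simp: power_emod_def PiE_def)
  have smul: "smult (power_emod E X) r p = (\<lambda>x\<in>X. smult E r (p x))"
    and ort: "orth (power_emod E X) p = (\<lambda>x\<in>X. orth E (p x))"
    and zer: "zero (power_emod E X) = (\<lambda>x\<in>X. zero E)" for r p
    by (simp_all add: power_emod_def)
  show ?thesis
  proof unfold_locales
    fix p q z assume "p \<in> carrier (power_emod E X)" "q \<in> carrier (power_emod E X)"
      "psum (power_emod E X) p q = Some z"
    then show "z \<in> carrier (power_emod E X)" unfolding sum crr using psum_closed by blast
  next
    show "zero (power_emod E X) \<in> carrier (power_emod E X)" by (simp add: crr zer)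
  next
    fix p assume "p \<in> carrier (power_emod E X)"
    then show "orth (power_emod E X) p \<in> carrier (power_emod E X)" by (simp add: crr ort)
  next
    fix p q assume "p \<in> carrier (power_emod E X)" "q \<in> carrier (power_emod E X)"
    then have "psum E (p x) (q x) = psum E (q x) (p x)" if "x \<in> X" for x
      using that by (intro psum_comm) (auto simp: crr)
    then show "psum (power_emod E X) p q = psum (power_emod E X) q p"
      by (auto simp: power_emod_def restrict_def)
  next
    fix p q r assume pqr: "p \<in> carrier (power_emod E X)" "q \<in> carrier (power_emod E X)"
      "r \<in> carrier (power_emod E X)"
    have assoc: "Option.bind (psum E (p x) (q x)) (\<lambda>s. psum E s (r x)) =
        Option.bind (psum E (q x) (r x)) (\<lambda>t. psum E (p x) t)" if "x \<in> X" for x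
      using pqr that by (intro psum_assoc) (auto simp: crr)
    have "(\<exists>s. psum (power_emod E X) p q = Some s \<and> psum (power_emod E X) s r = Some z) \<longleftrightarrow>
        (\<exists>t. psum (power_emod E X) q r = Some t \<and> psum (power_emod E X) p t = Some z)" for z
    proof
      assume "\<exists>s. psum (power_emod E X) p q = Some s \<and> psum (power_emod E X) s r = Some z"
      then obtain s where s: "z \<in> extensional X" "\<forall>x\<in>X. psum E (p x) (q x) = Some (s x)"
        "\<forall>x\<in>X. psum E (s x) (r x) = Some (z x)" by (auto simp: sum)
      have "\<exists>t. psum E (q x) (r x) = Some t \<and> psum E (p x) t = Some (z x)" if "x \<in> X" for x
        using assoc[OF that] s that by (auto split: bind_splits)
      then obtain t where "\<forall>x\<in>X. psum E (q x) (r x) = Some (t x) \<and> psum E (p x) (t x) = Some (z x)"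
        by metis
      then show "\<exists>t. psum (power_emod E X) q r = Some t \<and> psum (power_emod E X) p t = Some z"
        using s(1) by (intro exI[of _ "restrict t X"]) (auto simp: sum)
    next
      assume "\<exists>t. psum (power_emod E X) q r = Some t \<and> psum (power_emod E X) p t = Some z"
      then obtain t where t: "z \<in> extensional X" "\<forall>x\<in>X. psum E (q x) (r x) = Some (t x)"
        "\<forall>x\<in>X. psum E (p x) (t x) = Some (z x)" by (auto simp: sum)
      have "\<exists>s. psum E (p x) (q x) = Some s \<and> psum E s (r x) = Some (z x)" if "x \<in> X" for x
        using assoc[OF that] t that by (auto split: bind_splits)
      then obtain s where "\<forall>x\<in>X. psum E (p x) (q x) = Some (s x) \<and> psum E (s x) (r x) = Some (z x)"
        by metis
      then show "\<exists>s. psum (power_emod E X) p q = Some s \<and> psum (power_emod E X) s r = Some z"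
        using t(1) by (intro exI[of _ "restrict s X"]) (auto simp: sum)
    qed
    then have "Option.bind (psum (power_emod E X) p q) (\<lambda>s. psum (power_emod E X) s r) = Some z
      \<longleftrightarrow> Option.bind (psum (power_emod E X) q r) (psum (power_emod E X) p) = Some z" for z
      by (simp add: bind_eq_Some_conv)
    then show "Option.bind (psum (power_emod E X) p q) (\<lambda>s. psum (power_emod E X) s r) =
        Option.bind (psum (power_emod E X) q r) (psum (power_emod E X) p)"
      by (metis not_None_eq)
  next
    fix p assume "p \<in> carrier (power_emod E X)"
    then show "psum (power_emod E X) p (zero (power_emod E X)) = Some p"
      by (simp add: sum crr zer psum_zero)
  next
    fix p assume "p \<in> carrier (power_emod E X)"
    then show "psum (power_emod E X) p (orth (power_emod E X) p) = Some (one (power_emod E X))"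
      by (simp add: sum crr ort one_power_emod psum_orth)
  next
    fix p q assume "p \<in> carrier (power_emod E X)" "q \<in> carrier (power_emod E X)"
      "psum (power_emod E X) p q = Some (one (power_emod E X))"
    then show "q = orth (power_emod E X) p"
      by (intro ext) (auto simp: sum crr ort one_power_emod intro: orth_unique)
  next
    fix p assume p: "p \<in> carrier (power_emod E X)"
      and "psum (power_emod E X) p (one (power_emod E X)) \<noteq> None"
    then obtain r where "psum (power_emod E X) p (one (power_emod E X)) = Some r" by blast
    with p show "p = zero (power_emod E X)"
      by (intro ext) (auto simp: sum crr zer one_power_emod intro: psum_one)
  next
    fix r :: real and p assume "r \<in> {0..1}" "p \<in> carrier (power_emod E X)"
    then show "smult (power_emod E X) r p \<in> carrier (power_emod E X)" by (simp add: crr smul)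
  next
    fix p assume "p \<in> carrier (power_emod E X)"
    then show "smult (power_emod E X) 1 p = p"
      by (intro ext) (auto simp: crr smul smult_one)
  next
    fix r s :: real and p assume "r \<in> {0..1}" "s \<in> {0..1}" "p \<in> carrier (power_emod E X)"
    then show "smult (power_emod E X) (r * s) p = smult (power_emod E X) r (smult (power_emod E X) s p)"
      by (auto simp: crr smul smult_smult intro!: restrict_ext)
  next
    fix r s :: real and p assume "r \<in> {0..1}" "s \<in> {0..1}" "r + s \<le> 1" "p \<in> carrier (power_emod E X)"
    then show "psum (power_emod E X) (smult (power_emod E X) r p) (smult (power_emod E X) s p)
        = Some (smult (power_emod E X) (r + s) p)"
      by (auto simp: crr smul sum smult_add)
  next
    fix r :: real and p q z assume "r \<in> {0..1}" "p \<in> carrier (power_emod E X)"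
      "q \<in> carrier (power_emod E X)" "psum (power_emod E X) p q = Some z"
    then show "psum (power_emod E X) (smult (power_emod E X) r p) (smult (power_emod E X) r q)
        = Some (smult (power_emod E X) r z)"
      by (auto simp: crr smul sum smult_psum)
  qed
qed

section \<open>The expectation monad\<close>

text \<open>Sets are represented by arbitrary (possibly empty) subsets of arbitrary types, and an arrow
  from \<open>X\<close> to \<open>Y\<close> is an element of \<open>X \<rightarrow>\<^sub>E Y\<close>.\<close>

lemma compose_in: "f \<in> X \<rightarrow>\<^sub>E Y \<Longrightarrow> g \<in> Y \<rightarrow>\<^sub>E Z \<Longrightarrow> compose X g f \<in> X \<rightarrow>\<^sub>E Z"
  by (auto simp: compose_def PiE_iff)

lemma compose_apply: "x \<in> X \<Longrightarrow> compose X g f x = g (f x)"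
  by (simp add: compose_def)

definition expect :: "'x set \<Rightarrow> (('x \<Rightarrow> real) \<Rightarrow> real) set" where
  "expect X = emod_hom (power_emod unit_emod X) unit_emod"

definition expect_map ::
  "'x set \<Rightarrow> 'y set \<Rightarrow> ('x \<Rightarrow> 'y) \<Rightarrow> (('x \<Rightarrow> real) \<Rightarrow> real) \<Rightarrow> (('y \<Rightarrow> real) \<Rightarrow> real)" where
  "expect_map X Y f = (\<lambda>h\<in>expect X. \<lambda>p\<in>(Y \<rightarrow>\<^sub>E {0..1}). h (compose X p f))"

definition expect_unit :: "'x set \<Rightarrow> 'x \<Rightarrow> (('x \<Rightarrow> real) \<Rightarrow> real)" where
  "expect_unit X = (\<lambda>x\<in>X. \<lambda>p\<in>(X \<rightarrow>\<^sub>E {0..1}). p x)"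

definition expect_mult ::
  "'x set \<Rightarrow> (((('x \<Rightarrow> real) \<Rightarrow> real) \<Rightarrow> real) \<Rightarrow> real) \<Rightarrow> (('x \<Rightarrow> real) \<Rightarrow> real)" where
  "expect_mult X = (\<lambda>h\<in>expect (expect X). \<lambda>p\<in>(X \<rightarrow>\<^sub>E {0..1}). h (\<lambda>k\<in>expect X. k p))"

lemma expect_iff:
  "h \<in> expect X \<longleftrightarrow> h \<in> (X \<rightarrow>\<^sub>E {0..1}) \<rightarrow>\<^sub>E {0..1} \<and> h (\<lambda>x\<in>X. 1) = 1 \<and>
     (\<forall>p \<in> X \<rightarrow>\<^sub>E {0..1}. \<forall>q \<in> X \<rightarrow>\<^sub>E {0..1}. (\<forall>x\<in>X. p x + q x \<le> 1) \<longrightarrow>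
        h (\<lambda>x\<in>X. p x + q x) = h p + h q) \<and>
     (\<forall>r \<in> {0..1}. \<forall>p \<in> X \<rightarrow>\<^sub>E {0..1}. h (\<lambda>x\<in>X. r * p x) = r * h p)"
proof -
  have car: "carrier (power_emod unit_emod X) = X \<rightarrow>\<^sub>E {0..1}" "carrier unit_emod = {0..1}"
    by (simp_all add: power_emod_def unit_emod_def)
  have smul: "smult (power_emod unit_emod X) r p = (\<lambda>x\<in>X. r * p x)" "smult unit_emod r a = r * a"
    for r p a by (simp_all add: power_emod_def unit_emod_def)
  have psm: "psum unit_emod a b = Some c \<longleftrightarrow> a + b \<le> 1 \<and> c = a + b" for a b c
    by (auto simp: unit_emod_def)
  have "(\<lambda>x\<in>X. the (psum unit_emod (p x) (q x))) = (\<lambda>x\<in>X. p x + q x)"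
    if "\<forall>x\<in>X. p x + q x \<le> 1" for p q
    using that by (intro restrict_ext) (simp add: unit_emod_def)
  moreover have "psum unit_emod a b \<noteq> None \<longleftrightarrow> a + b \<le> 1" for a b
    by (simp add: unit_emod_def)
  ultimately have sum: "psum (power_emod unit_emod X) p q = Some z \<longleftrightarrow>
      (\<forall>x\<in>X. p x + q x \<le> 1) \<and> z = (\<lambda>x\<in>X. p x + q x)" for p q z
    by (simp add: power_emod_def eq_commute[of z])
  have le: "h p + h q \<le> 1"
    if h: "h \<in> (X \<rightarrow>\<^sub>E {0..1}) \<rightarrow>\<^sub>E {0..1}" and pq: "p \<in> X \<rightarrow>\<^sub>E {0..1}" "q \<in> X \<rightarrow>\<^sub>E {0..1}"
      "\<forall>x\<in>X. p x + q x \<le> 1" and eq: "h (\<lambda>x\<in>X. p x + q x) = h p + h q" for p q :: "_ \<Rightarrow> real"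
  proof -
    have "(\<lambda>x\<in>X. p x + q x) \<in> X \<rightarrow>\<^sub>E {0..1}" using pq by (auto simp: PiE_iff)
    then have "h (\<lambda>x\<in>X. p x + q x) \<in> {0..1}" by (rule PiE_mem[OF h])
    then show ?thesis by (simp add: eq)
  qed
  show ?thesis
    unfolding expect_def emod_hom_def one_power_emod one_unit_emod car smul sum psm mem_Collect_eq
    using le by (intro conj_cong refl iffI) (auto simp del: restrict_apply)
qed

lemma expect_apply_in: "h \<in> expect X \<Longrightarrow> p \<in> X \<rightarrow>\<^sub>E {0..1} \<Longrightarrow> h p \<in> {0..1}"
  unfolding expect_iff by blast

lemma expect_one: "h \<in> expect X \<Longrightarrow> h (\<lambda>x\<in>X. 1) = 1"
  unfolding expect_iff by blast

lemma expect_add: "h \<in> expect X \<Longrightarrow> p \<in> X \<rightarrow>\<^sub>E {0..1} \<Longrightarrow> q \<in> X \<rightarrow>\<^sub>E {0..1} \<Longrightarrow>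
    \<forall>x\<in>X. p x + q x \<le> 1 \<Longrightarrow> h (\<lambda>x\<in>X. p x + q x) = h p + h q"
  unfolding expect_iff by blast

lemma expect_scale: "h \<in> expect X \<Longrightarrow> r \<in> {0..1} \<Longrightarrow> p \<in> X \<rightarrow>\<^sub>E {0..1} \<Longrightarrow>
    h (\<lambda>x\<in>X. r * p x) = r * h p"
  unfolding expect_iff by blast

lemma eval_expect_in: "p \<in> X \<rightarrow>\<^sub>E {0..1} \<Longrightarrow> (\<lambda>k\<in>expect X. k p) \<in> expect X \<rightarrow>\<^sub>E {0..1}"
  using expect_apply_in by fastforce

lemma eval_in_expect:
  assumes H: "h \<in> expect A" and e: "\<And>p. p \<in> X \<rightarrow>\<^sub>E {0..1} \<Longrightarrow> e p \<in> A \<rightarrow>\<^sub>E {0..1}"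
    and e1: "e (\<lambda>x\<in>X. 1) = (\<lambda>a\<in>A. 1)"
    and e2: "\<And>p q. p \<in> X \<rightarrow>\<^sub>E {0..1} \<Longrightarrow> q \<in> X \<rightarrow>\<^sub>E {0..1} \<Longrightarrow> \<forall>x\<in>X. p x + q x \<le> 1 \<Longrightarrow>
      e (\<lambda>x\<in>X. p x + q x) = (\<lambda>a\<in>A. e p a + e q a)"
    and e3: "\<And>r p. r \<in> {0..1} \<Longrightarrow> p \<in> X \<rightarrow>\<^sub>E {0..1} \<Longrightarrow> e (\<lambda>x\<in>X. r * p x) = (\<lambda>a\<in>A. r * e p a)"
  shows "(\<lambda>p\<in>(X \<rightarrow>\<^sub>E {0..1}). h (e p)) \<in> expect X"
proof -
  have 2: "(\<lambda>y\<in>X. p y + q y) \<in> X \<rightarrow>\<^sub>E {0..1}" if "p \<in> X \<rightarrow>\<^sub>E {0..1}" "q \<in> X \<rightarrow>\<^sub>E {0..1}"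
    "\<forall>x\<in>X. p x + q x \<le> 1" for p q :: "_ \<Rightarrow> real"
    using that by (fastforce simp: PiE_iff)
  have 3: "(\<lambda>y\<in>X. r * p y) \<in> X \<rightarrow>\<^sub>E {0..1}" if "p \<in> X \<rightarrow>\<^sub>E {0..1}" "r \<in> {0..1}"
    for p :: "_ \<Rightarrow> real" and r
    using that by (auto simp: PiE_iff mult_le_one)
  have 4: "(\<lambda>y\<in>X. 1::real) \<in> X \<rightarrow>\<^sub>E {0..1}" by auto
  have 5: "\<forall>a\<in>A. e p a + e q a \<le> 1" if pq: "p \<in> X \<rightarrow>\<^sub>E {0..1}" "q \<in> X \<rightarrow>\<^sub>E {0..1}" "\<forall>x\<in>X. p x + q x \<le> 1" for p q
  proof
    fix a assume a: "a \<in> A"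
    have "e (\<lambda>x\<in>X. p x + q x) a \<in> {0..1}" using e[OF 2[OF pq]] a by blast
    then show "e p a + e q a \<le> 1" using a by (simp add: e2[OF pq])
  qed
  note H' = H[unfolded expect_iff]
  show ?thesis
    unfolding expect_iff
  proof (intro conjI ballI impI)
    show "(\<lambda>p\<in>X \<rightarrow>\<^sub>E {0..1}. h (e p)) \<in> (X \<rightarrow>\<^sub>E {0..1}) \<rightarrow>\<^sub>E {0..1}"
      using expect_apply_in[OF H e] by auto
    show "(\<lambda>p\<in>X \<rightarrow>\<^sub>E {0..1}. h (e p)) (\<lambda>x\<in>X. 1) = 1" using H' 4 by (simp only: restrict_apply' e1)
  next
    fix p q assume pq: "p \<in> X \<rightarrow>\<^sub>E {0..1}" "q \<in> X \<rightarrow>\<^sub>E {0..1::real}" "\<forall>x\<in>X. p x + q x \<le> 1"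
    then show "(\<lambda>p\<in>X \<rightarrow>\<^sub>E {0..1}. h (e p)) (\<lambda>x\<in>X. p x + q x) =
        (\<lambda>p\<in>X \<rightarrow>\<^sub>E {0..1}. h (e p)) p + (\<lambda>p\<in>X \<rightarrow>\<^sub>E {0..1}. h (e p)) q"
      using H' 2[OF pq] 5[OF pq] e by (simp only: restrict_apply' e2)
  next
    fix r :: real and p assume rp: "r \<in> {0..1}" "p \<in> X \<rightarrow>\<^sub>E {0..1::real}"
    then show "(\<lambda>p\<in>X \<rightarrow>\<^sub>E {0..1}. h (e p)) (\<lambda>x\<in>X. r * p x) = r * (\<lambda>p\<in>X \<rightarrow>\<^sub>E {0..1}. h (e p)) p"
      using H' 3[OF rp(2,1)] e by (simp only: restrict_apply' e3)
  qed
qed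

lemma expect_map_in:
  assumes "f \<in> X \<rightarrow>\<^sub>E Y"
  shows "expect_map X Y f \<in> expect X \<rightarrow>\<^sub>E expect Y"
proof -
  have "(\<lambda>p\<in>(Y \<rightarrow>\<^sub>E {0..1}). h (compose X p f)) \<in> expect Y" if "h \<in> expect X" for h
    using that
  proof (rule eval_in_expect)
    show "compose X p f \<in> X \<rightarrow>\<^sub>E {0..1}" if "p \<in> Y \<rightarrow>\<^sub>E {0..1}" for p :: "_ \<Rightarrow> real"
      using compose_in[OF assms that] .
  qed (use assms in \<open>auto simp: compose_def PiE_iff intro!: restrict_ext\<close>)
  then show ?thesis by (simp add: expect_map_def)
qed

lemma expect_unit_in: "expect_unit X \<in> X \<rightarrow>\<^sub>E expect X"
proof -
  have "(\<lambda>p\<in>(X \<rightarrow>\<^sub>E {0..1}). p x) \<in> expect X" if x: "x \<in> X" for x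
  proof -
    have "(\<lambda>q\<in>({x} \<rightarrow>\<^sub>E {0..1}). q x) \<in> expect {x}"
      unfolding expect_iff by (auto simp: PiE_iff add_nonneg_nonneg mult_le_one)
    then have "(\<lambda>p\<in>(X \<rightarrow>\<^sub>E {0..1}). (\<lambda>q\<in>({x} \<rightarrow>\<^sub>E {0..1}). q x) (restrict p {x})) \<in> expect X"
      by (rule eval_in_expect) (use x in \<open>auto simp: PiE_iff intro!: restrict_ext\<close>)
    also have "(\<lambda>p\<in>(X \<rightarrow>\<^sub>E {0..1}). (\<lambda>q\<in>({x} \<rightarrow>\<^sub>E {0..1}). q x) (restrict p {x}))
        = (\<lambda>p\<in>(X \<rightarrow>\<^sub>E {0..1::real}). p x)"
      using x by (intro restrict_ext) auto
    finally show ?thesis .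
  qed
  then show ?thesis by (simp add: expect_unit_def)
qed

lemma expect_mult_in: "expect_mult X \<in> expect (expect X) \<rightarrow>\<^sub>E expect X"
proof -
  have "(\<lambda>p\<in>(X \<rightarrow>\<^sub>E {0..1}). h (\<lambda>k\<in>expect X. k p)) \<in> expect X" if "h \<in> expect (expect X)" for h
    using that
  proof (rule eval_in_expect)
    show "(\<lambda>k\<in>expect X. k p) \<in> expect X \<rightarrow>\<^sub>E {0..1}" if "p \<in> X \<rightarrow>\<^sub>E {0..1}" for p
      by (rule eval_expect_in[OF that])
  qed (simp_all add: expect_one expect_add expect_scale cong: restrict_cong)
  then show ?thesis by (simp add: expect_mult_def)
qed

lemma expect_eqI:
  assumes "F \<in> A \<rightarrow>\<^sub>E expect X" "G \<in> A \<rightarrow>\<^sub>E expect X"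
    and "\<And>h p. h \<in> A \<Longrightarrow> p \<in> X \<rightarrow>\<^sub>E {0..1} \<Longrightarrow> F h p = G h p"
  shows "F = G"
proof (rule PiE_ext[OF assms(1,2)])
  fix h assume h: "h \<in> A"
  show "F h = G h"
    by (rule PiE_ext[of _ "X \<rightarrow>\<^sub>E {0..1}" "\<lambda>_. {0..1}"])
      (use assms h in \<open>auto simp: expect_iff PiE_iff\<close>)
qed

lemma expect_map_apply:
  "h \<in> expect X \<Longrightarrow> p \<in> Y \<rightarrow>\<^sub>E {0..1} \<Longrightarrow> expect_map X Y f h p = h (compose X p f)"
  by (simp add: expect_map_def)

lemma expect_unit_apply: "x \<in> X \<Longrightarrow> p \<in> X \<rightarrow>\<^sub>E {0..1} \<Longrightarrow> expect_unit X x p = p x"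
  by (simp add: expect_unit_def)

lemma expect_mult_apply:
  "h \<in> expect (expect X) \<Longrightarrow> p \<in> X \<rightarrow>\<^sub>E {0..1} \<Longrightarrow> expect_mult X h p = h (\<lambda>k\<in>expect X. k p)"
  by (simp add: expect_mult_def)

lemmas expect_in = PiE_mem[OF expect_map_in] PiE_mem[OF expect_unit_in] PiE_mem[OF expect_mult_in]
lemmas expect_apply = expect_map_apply expect_unit_apply expect_mult_apply

lemma expect_map_id: "expect_map X X (\<lambda>x\<in>X. x) = (\<lambda>h\<in>expect X. h)"
proof -
  have [simp]: "compose X p (\<lambda>x\<in>X. x) = p" if "p \<in> X \<rightarrow>\<^sub>E {0..1}" for p :: "_ \<Rightarrow> real"
    using that by (intro PiE_ext[of _ X "\<lambda>_. {0..1}"]) (auto simp: compose_def)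
  show ?thesis
    by (rule expect_eqI[of _ "expect X" X])
      (auto simp del: PiE_restrict simp: expect_map_apply intro!: expect_map_in)
qed

lemma expect_map_compose:
  assumes f: "f \<in> X \<rightarrow>\<^sub>E Y" and g: "g \<in> Y \<rightarrow>\<^sub>E Z"
  shows "expect_map X Z (compose X g f) = compose (expect X) (expect_map Y Z g) (expect_map X Y f)"
proof (rule expect_eqI[OF expect_map_in[OF compose_in[OF f g]]
        compose_in[OF expect_map_in[OF f] expect_map_in[OF g]]])
  fix h and p :: "_ \<Rightarrow> real" assume "h \<in> expect X" and p: "p \<in> Z \<rightarrow>\<^sub>E {0..1}"
  moreover have "compose X (compose Y p g) f = compose X p (compose X g f)"
    using f by (auto simp: compose_def intro!: restrict_ext)
  ultimately show "expect_map X Z (compose X g f) h p =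
      compose (expect X) (expect_map Y Z g) (expect_map X Y f) h p"
    by (simp add: compose_apply expect_apply expect_in(1)[OF f] compose_in[OF g p])
qed

lemma expect_unit_natural:
  assumes f: "f \<in> X \<rightarrow>\<^sub>E Y"
  shows "compose X (expect_map X Y f) (expect_unit X) = compose X (expect_unit Y) f"
  using PiE_mem[OF f]
  by (intro expect_eqI[OF compose_in[OF expect_unit_in expect_map_in[OF f]]
        compose_in[OF f expect_unit_in]])
    (simp add: compose_apply expect_apply expect_in compose_in[OF f])

lemma expect_mult_natural:
  assumes f: "f \<in> X \<rightarrow>\<^sub>E Y"
  shows "compose (expect (expect X)) (expect_map X Y f) (expect_mult X) =
    compose (expect (expect X)) (expect_mult Y) (expect_map (expect X) (expect Y) (expect_map X Y f))"
proof (rule expect_eqI[OF compose_in[OF expect_mult_in expect_map_in[OF f]]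
        compose_in[OF expect_map_in[OF expect_map_in[OF f]] expect_mult_in]])
  fix h p assume "h \<in> expect (expect X)" and p: "p \<in> Y \<rightarrow>\<^sub>E {0..1::real}"
  moreover have "compose (expect X) (\<lambda>k\<in>expect Y. k p) (expect_map X Y f)
      = (\<lambda>k\<in>expect X. k (compose X p f))"
    using p by (auto simp: compose_def expect_in(1)[OF f] expect_apply intro!: restrict_ext)
  ultimately show "compose (expect (expect X)) (expect_map X Y f) (expect_mult X) h p =
    compose (expect (expect X)) (expect_mult Y) (expect_map (expect X) (expect Y) (expect_map X Y f)) h p"
    by (simp add: compose_apply expect_apply expect_in(1)[OF f] expect_in(3)
        expect_in(1)[OF expect_map_in[OF f]] compose_in[OF f p] eval_expect_in[OF p]
        del: restrict_PiE)
qed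

lemma expect_mult_unit:
  "compose (expect X) (expect_mult X) (expect_unit (expect X)) = (\<lambda>h\<in>expect X. h)"
  by (rule expect_eqI[OF compose_in[OF expect_unit_in expect_mult_in]])
    (simp, simp add: compose_apply expect_apply expect_in eval_expect_in del: restrict_PiE)

lemma expect_mult_map_unit:
  "compose (expect X) (expect_mult X) (expect_map X (expect X) (expect_unit X)) = (\<lambda>h\<in>expect X. h)"
proof (rule expect_eqI[OF compose_in[OF expect_map_in[OF expect_unit_in] expect_mult_in]])
  fix h p assume "h \<in> expect X" and p: "p \<in> X \<rightarrow>\<^sub>E {0..1::real}"
  moreover have "compose X (\<lambda>k\<in>expect X. k p) (expect_unit X) = p"
    using p by (intro PiE_ext[of _ X "\<lambda>_. {0..1}", OF _ p] compose_in[OF expect_unit_in eval_expect_in])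
      (auto simp: compose_def expect_in expect_apply)
  ultimately show "compose (expect X) (expect_mult X) (expect_map X (expect X) (expect_unit X)) h p =
      (\<lambda>h\<in>expect X. h) h p"
    by (simp add: compose_apply expect_apply expect_in(1)[OF expect_unit_in] eval_expect_in
        del: restrict_PiE)
qed simp

lemma expect_mult_mult:
  "compose (expect (expect (expect X))) (expect_mult X) (expect_mult (expect X)) =
   compose (expect (expect (expect X))) (expect_mult X)
     (expect_map (expect (expect X)) (expect X) (expect_mult X))"
proof (rule expect_eqI[OF compose_in[OF expect_mult_in expect_mult_in]
      compose_in[OF expect_map_in[OF expect_mult_in] expect_mult_in]])
  fix h p assume "h \<in> expect (expect (expect X))" and p: "p \<in> X \<rightarrow>\<^sub>E {0..1::real}"
  moreover have "compose (expect (expect X)) (\<lambda>k\<in>expect X. k p) (expect_mult X) =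
      (\<lambda>k\<in>expect (expect X). k (\<lambda>k\<in>expect X. k p))"
    using p by (auto simp: compose_def expect_in expect_apply intro!: restrict_ext)
  ultimately show "compose (expect (expect (expect X))) (expect_mult X) (expect_mult (expect X)) h p =
    compose (expect (expect (expect X))) (expect_mult X)
     (expect_map (expect (expect X)) (expect X) (expect_mult X)) h p"
    by (simp add: compose_apply expect_apply expect_in(1)[OF expect_mult_in] expect_in(3) eval_expect_in
        del: restrict_PiE)
qed

section \<open>The continuation monad\<close>

definition cont :: "'c set \<Rightarrow> 'x set \<Rightarrow> (('x \<Rightarrow> 'c) \<Rightarrow> 'c) set" where
  "cont C X = (X \<rightarrow>\<^sub>E C) \<rightarrow>\<^sub>E C"

definition cont_map ::
  "'c set \<Rightarrow> 'x set \<Rightarrow> 'y set \<Rightarrow> ('x \<Rightarrow> 'y) \<Rightarrow> (('x \<Rightarrow> 'c) \<Rightarrow> 'c) \<Rightarrow> (('y \<Rightarrow> 'c) \<Rightarrow> 'c)" where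
  "cont_map C X Y f = (\<lambda>h\<in>cont C X. \<lambda>g\<in>(Y \<rightarrow>\<^sub>E C). h (compose X g f))"

definition cont_unit :: "'c set \<Rightarrow> 'x set \<Rightarrow> 'x \<Rightarrow> (('x \<Rightarrow> 'c) \<Rightarrow> 'c)" where
  "cont_unit C X = (\<lambda>x\<in>X. \<lambda>g\<in>(X \<rightarrow>\<^sub>E C). g x)"

definition cont_mult ::
  "'c set \<Rightarrow> 'x set \<Rightarrow> (((('x \<Rightarrow> 'c) \<Rightarrow> 'c) \<Rightarrow> 'c) \<Rightarrow> 'c) \<Rightarrow> (('x \<Rightarrow> 'c) \<Rightarrow> 'c)" where
  "cont_mult C X = (\<lambda>H\<in>cont C (cont C X). \<lambda>g\<in>(X \<rightarrow>\<^sub>E C). H (\<lambda>k\<in>cont C X. k g))"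

lemma eval_cont_in: "p \<in> X \<rightarrow>\<^sub>E C \<Longrightarrow> (\<lambda>k\<in>cont C X. k p) \<in> cont C X \<rightarrow>\<^sub>E C"
  by (auto simp: cont_def)

lemma cont_map_in:
  assumes "f \<in> X \<rightarrow>\<^sub>E Y"
  shows "cont_map C X Y f \<in> cont C X \<rightarrow>\<^sub>E cont C Y"
proof -
  have "(\<lambda>p\<in>(Y \<rightarrow>\<^sub>E C). h (compose X p f)) \<in> (Y \<rightarrow>\<^sub>E C) \<rightarrow>\<^sub>E C" if "h \<in> cont C X" for h
    using that compose_in[OF assms] unfolding cont_def by auto
  then show ?thesis by (simp add: cont_map_def cont_def)
qed

lemma cont_unit_in: "cont_unit C X \<in> X \<rightarrow>\<^sub>E cont C X"
  unfolding cont_unit_def cont_def by (auto simp: Pi_iff)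

lemma cont_mult_in: "cont_mult C X \<in> cont C (cont C X) \<rightarrow>\<^sub>E cont C X"
proof -
  have "(\<lambda>p\<in>(X \<rightarrow>\<^sub>E C). h (\<lambda>k\<in>cont C X. k p)) \<in> (X \<rightarrow>\<^sub>E C) \<rightarrow>\<^sub>E C" if "h \<in> cont C (cont C X)" for h
  proof -
    have "h \<in> (cont C X \<rightarrow>\<^sub>E C) \<rightarrow>\<^sub>E C" using that by (simp add: cont_def)
    from PiE_mem[OF this eval_cont_in] show ?thesis by simp
  qed
  then show ?thesis by (simp add: cont_mult_def cont_def)
qed

lemma cont_eqI:
  assumes "F \<in> A \<rightarrow>\<^sub>E cont C X" "G \<in> A \<rightarrow>\<^sub>E cont C X"
    and "\<And>h p. h \<in> A \<Longrightarrow> p \<in> X \<rightarrow>\<^sub>E C \<Longrightarrow> F h p = G h p"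
  shows "F = G"
proof (rule PiE_ext[OF assms(1,2)])
  fix h assume h: "h \<in> A"
  show "F h = G h"
    by (rule PiE_ext[of _ "X \<rightarrow>\<^sub>E C" "\<lambda>_. C"]) (use assms h in \<open>auto simp: cont_def PiE_iff\<close>)
qed

lemma cont_map_apply:
  "h \<in> cont C X \<Longrightarrow> p \<in> Y \<rightarrow>\<^sub>E C \<Longrightarrow> cont_map C X Y f h p = h (compose X p f)"
  by (simp add: cont_map_def)

lemma cont_unit_apply: "x \<in> X \<Longrightarrow> p \<in> X \<rightarrow>\<^sub>E C \<Longrightarrow> cont_unit C X x p = p x"
  by (simp add: cont_unit_def)

lemma cont_mult_apply:
  "h \<in> cont C (cont C X) \<Longrightarrow> p \<in> X \<rightarrow>\<^sub>E C \<Longrightarrow> cont_mult C X h p = h (\<lambda>k\<in>cont C X. k p)"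
  by (simp add: cont_mult_def)

lemmas cont_in = PiE_mem[OF cont_map_in] PiE_mem[OF cont_unit_in] PiE_mem[OF cont_mult_in]
lemmas cont_apply = cont_map_apply cont_unit_apply cont_mult_apply

lemma cont_map_id: "cont_map C X X (\<lambda>x\<in>X. x) = (\<lambda>h\<in>cont C X. h)"
proof -
  have [simp]: "compose X p (\<lambda>x\<in>X. x) = p" if "p \<in> X \<rightarrow>\<^sub>E C" for p :: "_ \<Rightarrow> _"
    using that by (intro PiE_ext[of _ X "\<lambda>_. C"]) (auto simp: compose_def)
  show ?thesis
    by (rule cont_eqI[of _ "cont C X" C X])
      (auto simp del: PiE_restrict simp: cont_map_apply intro!: cont_map_in)
qed

lemma cont_map_compose:
  assumes f: "f \<in> X \<rightarrow>\<^sub>E Y" and g: "g \<in> Y \<rightarrow>\<^sub>E Z"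
  shows "cont_map C X Z (compose X g f) = compose (cont C X) (cont_map C Y Z g) (cont_map C X Y f)"
proof (rule cont_eqI[OF cont_map_in[OF compose_in[OF f g]]
        compose_in[OF cont_map_in[OF f] cont_map_in[OF g]]])
  fix h and p :: "_ \<Rightarrow> _" assume "h \<in> cont C X" and p: "p \<in> Z \<rightarrow>\<^sub>E C"
  moreover have "compose X (compose Y p g) f = compose X p (compose X g f)"
    using f by (auto simp: compose_def intro!: restrict_ext)
  ultimately show "cont_map C X Z (compose X g f) h p =
      compose (cont C X) (cont_map C Y Z g) (cont_map C X Y f) h p"
    by (simp add: compose_apply cont_apply cont_in(1)[OF f] compose_in[OF g p])
qed

lemma cont_unit_natural:
  assumes f: "f \<in> X \<rightarrow>\<^sub>E Y"
  shows "compose X (cont_map C X Y f) (cont_unit C X) = compose X (cont_unit C Y) f"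
  using PiE_mem[OF f]
  by (intro cont_eqI[OF compose_in[OF cont_unit_in cont_map_in[OF f]]
        compose_in[OF f cont_unit_in]])
    (simp add: compose_apply cont_apply cont_in compose_in[OF f])

lemma cont_mult_natural:
  assumes f: "f \<in> X \<rightarrow>\<^sub>E Y"
  shows "compose (cont C (cont C X)) (cont_map C X Y f) (cont_mult C X) =
    compose (cont C (cont C X)) (cont_mult C Y) (cont_map C (cont C X) (cont C Y) (cont_map C X Y f))"
proof (rule cont_eqI[OF compose_in[OF cont_mult_in cont_map_in[OF f]]
        compose_in[OF cont_map_in[OF cont_map_in[OF f]] cont_mult_in]])
  fix h p assume "h \<in> cont C (cont C X)" and p: "p \<in> Y \<rightarrow>\<^sub>E C"
  moreover have "compose (cont C X) (\<lambda>k\<in>cont C Y. k p) (cont_map C X Y f)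
      = (\<lambda>k\<in>cont C X. k (compose X p f))"
    using p by (auto simp: compose_def cont_in(1)[OF f] cont_apply intro!: restrict_ext)
  ultimately show "compose (cont C (cont C X)) (cont_map C X Y f) (cont_mult C X) h p =
    compose (cont C (cont C X)) (cont_mult C Y) (cont_map C (cont C X) (cont C Y) (cont_map C X Y f)) h p"
    by (simp add: compose_apply cont_apply cont_in(1)[OF f] cont_in(3)
        cont_in(1)[OF cont_map_in[OF f]] compose_in[OF f p] eval_cont_in[OF p]
        del: restrict_PiE)
qed

lemma cont_mult_unit:
  "compose (cont C X) (cont_mult C X) (cont_unit C (cont C X)) = (\<lambda>h\<in>cont C X. h)"
  by (rule cont_eqI[OF compose_in[OF cont_unit_in cont_mult_in]])
    (simp, simp add: compose_apply cont_apply cont_in eval_cont_in del: restrict_PiE)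

lemma cont_mult_map_unit:
  "compose (cont C X) (cont_mult C X) (cont_map C X (cont C X) (cont_unit C X)) = (\<lambda>h\<in>cont C X. h)"
proof (rule cont_eqI[OF compose_in[OF cont_map_in[OF cont_unit_in] cont_mult_in]])
  fix h p assume "h \<in> cont C X" and p: "p \<in> X \<rightarrow>\<^sub>E C"
  moreover have "compose X (\<lambda>k\<in>cont C X. k p) (cont_unit C X) = p"
    using p by (intro PiE_ext[of _ X "\<lambda>_. C", OF _ p] compose_in[OF cont_unit_in eval_cont_in])
      (auto simp: compose_def cont_in cont_apply)
  ultimately show "compose (cont C X) (cont_mult C X) (cont_map C X (cont C X) (cont_unit C X)) h p =
      (\<lambda>h\<in>cont C X. h) h p"
    by (simp add: compose_apply cont_apply cont_in(1)[OF cont_unit_in] eval_cont_in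
        del: restrict_PiE)
qed simp

lemma cont_mult_mult:
  "compose (cont C (cont C (cont C X))) (cont_mult C X) (cont_mult C (cont C X)) =
   compose (cont C (cont C (cont C X))) (cont_mult C X)
     (cont_map C (cont C (cont C X)) (cont C X) (cont_mult C X))"
proof (rule cont_eqI[OF compose_in[OF cont_mult_in cont_mult_in]
      compose_in[OF cont_map_in[OF cont_mult_in] cont_mult_in]])
  fix h p assume "h \<in> cont C (cont C (cont C X))" and p: "p \<in> X \<rightarrow>\<^sub>E C"
  moreover have "compose (cont C (cont C X)) (\<lambda>k\<in>cont C X. k p) (cont_mult C X) =
      (\<lambda>k\<in>cont C (cont C X). k (\<lambda>k\<in>cont C X. k p))"
    using p by (auto simp: compose_def cont_in cont_apply intro!: restrict_ext)
  ultimately show "compose (cont C (cont C (cont C X))) (cont_mult C X) (cont_mult C (cont C X)) h p =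
    compose (cont C (cont C (cont C X))) (cont_mult C X)
     (cont_map C (cont C (cont C X)) (cont C X) (cont_mult C X)) h p"
    by (simp add: compose_apply cont_apply cont_in(1)[OF cont_mult_in] cont_in(3) eval_cont_in
        del: restrict_PiE)
qed

section \<open>The inclusion maps\<close>

definition expect_incl :: "'x set \<Rightarrow> (('x \<Rightarrow> real) \<Rightarrow> real) \<Rightarrow> (('x \<Rightarrow> real) \<Rightarrow> real)" where
  "expect_incl X = (\<lambda>h\<in>expect X. h)"

end

theory Submission
  imports Defs
begin

text \<open>Both monads are given by the same formulas: the functor precomposes, the unit evaluates,
  the multiplication feeds an evaluation map to the outer functional. \<open>expect\<close> merely
  keeps those functionals that respect the effect module structure. So each equation, tested on an
  argument and a predicate \<open>p\<close>, reads the same on both sides. Only the multiplication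
  needs care (\<open>expect_incl_mult\<close>): evaluation at \<open>p\<close> is a function on
  \<open>cont {0..1} X\<close> on one side and on \<open>expect X\<close> on the other.\<close>

lemma expect_subset_cont: "expect X \<subseteq> cont {0..1} X"
  by (rule subsetI) (simp add: cont_def expect_iff)

lemma expect_incl_in: "expect_incl X \<in> expect X \<rightarrow>\<^sub>E cont {0..1} X"
  using expect_subset_cont by (auto simp: expect_incl_def)

lemma expect_incl_apply: "h \<in> expect X \<Longrightarrow> expect_incl X h = h"
  by (simp add: expect_incl_def)

lemma expect_incl_natural:
  assumes f: "f \<in> X \<rightarrow>\<^sub>E Y"
  shows "compose (expect X) (cont_map {0..1} X Y f) (expect_incl X) =
    compose (expect X) (expect_incl Y) (expect_map X Y f)"
  using expect_subset_cont[of X]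
  by (intro cont_eqI[OF compose_in[OF expect_incl_in cont_map_in[OF f]]
        compose_in[OF expect_map_in[OF f] expect_incl_in]])
    (auto simp: compose_apply expect_incl_apply expect_in(1)[OF f] expect_apply cont_apply)

lemma expect_incl_unit: "compose X (expect_incl X) (expect_unit X) = cont_unit {0..1} X"
  by (rule cont_eqI[OF compose_in[OF expect_unit_in expect_incl_in] cont_unit_in])
    (simp add: compose_apply expect_incl_apply expect_in expect_apply cont_apply)

text \<open>The right side includes both layers, outer one first; by
  \<open>expect_incl_natural\<close> the other order would give the same map.\<close>

lemma expect_incl_mult:
  "compose (expect (expect X)) (expect_incl X) (expect_mult X) =
   compose (expect (expect X)) (cont_mult {0..1} X)
     (compose (expect (expect X))
        (cont_map {0..1} (expect X) (cont {0..1} X) (expect_incl X))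
        (expect_incl (expect X)))"
proof (rule cont_eqI[OF compose_in[OF expect_mult_in expect_incl_in]
      compose_in[OF compose_in[OF expect_incl_in cont_map_in[OF expect_incl_in]] cont_mult_in]])
  fix h p assume h: "h \<in> expect (expect X)" and p: "p \<in> X \<rightarrow>\<^sub>E {0..1::real}"
  \<comment> \<open>\<open>cont_map\<close> is \<open>undefined\<close> outside \<open>cont\<close>,
    so its evaluation rule needs this membership.\<close>
  have hc: "h \<in> cont {0..1} (expect X)" using h expect_subset_cont by blast
  \<comment> \<open>Evaluation at \<open>p\<close>, pulled back along the inclusion, is its
    restriction to \<open>expect X\<close>: exactly the predicate to which
    \<open>expect_mult\<close> applies \<open>h\<close>.\<close>
  have eval: "compose (expect X) (\<lambda>k\<in>cont {0..1} X. k p) (expect_incl X) = (\<lambda>k\<in>expect X. k p)"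
    using expect_subset_cont[of X]
    by (auto simp: compose_def expect_incl_apply intro!: restrict_ext)
  show "compose (expect (expect X)) (expect_incl X) (expect_mult X) h p =
    compose (expect (expect X)) (cont_mult {0..1} X)
     (compose (expect (expect X))
        (cont_map {0..1} (expect X) (cont {0..1} X) (expect_incl X))
        (expect_incl (expect X))) h p"
    using h hc p
    by (simp add: compose_apply expect_incl_apply expect_in(3) expect_apply cont_apply
        cont_in(1)[OF expect_incl_in] eval_cont_in eval del: restrict_PiE)
qed

theorem lemma15:
  fixes X :: "'x set" and Y :: "'y set"
  shows
    "expect X \<subseteq> cont {0..1} X \<and>
     expect_incl X \<in> expect X \<rightarrow>\<^sub>E cont {0..1} X \<and>
     (\<forall>f \<in> X \<rightarrow>\<^sub>E Y.
        compose (expect X) (cont_map {0..1} X Y f) (expect_incl X) =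
        compose (expect X) (expect_incl Y) (expect_map X Y f)) \<and>
     compose X (expect_incl X) (expect_unit X) = cont_unit {0..1} X \<and>
     compose (expect (expect X)) (expect_incl X) (expect_mult X) =
     compose (expect (expect X)) (cont_mult {0..1} X)
       (compose (expect (expect X))
          (cont_map {0..1} (expect X) (cont {0..1} X) (expect_incl X))
          (expect_incl (expect X)))"
  using expect_subset_cont expect_incl_in expect_incl_natural expect_incl_unit expect_incl_mult
  by blast

end
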